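(* Let $\mathfrak{g}$ be a finite dimensional complex quadratic vector space with bilinear form $B$ (non degenerate symmetric). Fix $I\in\bigwedge^3\mathfrak{g}$, set $\partial=-\frac12\,\mathrm{ad}_P(I)$, and let $F\colon\mathfrak{g}\times\mathfrak{g}\to\mathfrak{g}$ be the skew symmetric bilinear map associated to the derivation $\partial$ of $\bigwedge\mathfrak{g}$. Then $F$ is a Lie algebra structure on $\mathfrak{g}$ if and only if $\{I,I\}=0$. In that case, writing $[X,Y]=F(X,Y)$, one has $$I(X,Y,Z)=B([X,Y],Z),\qquad\forall\,X,Y,Z\in\mathfrak{g},$$ the form $B$ is invariant, and $\mathfrak{g}$ is a quadratic Lie algebra.
   Context: $\bigwedge\mathfrak{g}=\sum_p\bigwedge^p\mathfrak{g}$ is the algebra of skew symmetric multilinear forms on $\mathfrak{g}$, with the wedge product $(\Omega\wedge\Omega')(Y_1,\dots,Y_{p+q})=\sum_{\sigma}\varepsilon(\sigma)\Omega(Y_{\sigma(1)},\dots,Y_{\sigma(p)})\Omega'(Y_{\sigma(p+1)},\dots,Y_{\sigma(p+q)})$, the sum over permutations with $\sigma(1)<\dots<\sigma(p)$, $\sigma(p+1)<\dots<\sigma(p+q)$. $\iota_X\Omega(Y_1,\dots)=\Omega(X,Y_1,\dots)$ and $\iota_X(1)=0$. The super Poisson bracket on $\bigwedge\mathfrak{g}$ (depending on $B$) is $\{\Omega,\Omega'\}=2(-1)^{w+1}\sum_{j=1}^n\iota_{X_j}(\Omega)\wedge\iota_{X_j}(\Omega')$ for $\Omega\in\bigwedge^w\mathfrak{g}$,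 $\Omega'\in\bigwedge\mathfrak{g}$, where $\{X_1,\dots,X_n\}$ is any orthonormal basis of $\mathfrak{g}$ for $B$. $\mathrm{ad}_P(\Omega)=\{\Omega,\cdot\}$ is a graded derivation of $(\bigwedge\mathfrak{g},\wedge)$. To a degree-one derivation $D$ of $\bigwedge\mathfrak{g}$ is associated the unique skew symmetric bilinear $F\colon\mathfrak{g}\times\mathfrak{g}\to\mathfrak{g}$ such that $(D\omega)(Y,Z)=-\omega(F(Y,Z))$ for all $\omega\in\mathfrak{g}^*$, $Y,Z\in\mathfrak{g}$. A quadratic Lie algebra is a Lie algebra with a non degenerate symmetric invariant bilinear form. *)

theory Defs
  imports Complex_Main "HOL-Combinatorics.Permutations"
begin

text \<open>A complex vector space is given by its scalar multiplication \<open>scale\<close>.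
  The field of scalars itself carries the scalar multiplication \<open>(*)\<close>.\<close>

definition bilinear_map ::
  "(complex \<Rightarrow> 'g::ab_group_add \<Rightarrow> 'g) \<Rightarrow> (complex \<Rightarrow> 'h::ab_group_add \<Rightarrow> 'h) \<Rightarrow> ('g \<Rightarrow> 'g \<Rightarrow> 'h) \<Rightarrow> bool"
  where "bilinear_map s t f \<longleftrightarrow>
    (\<forall>x. Vector_Spaces.linear s t (\<lambda>y. f x y)) \<and> (\<forall>y. Vector_Spaces.linear s t (\<lambda>x. f x y))"

definition quadratic_space :: "(complex \<Rightarrow> 'g::ab_group_add \<Rightarrow> 'g) \<Rightarrow> ('g \<Rightarrow> 'g \<Rightarrow> complex) \<Rightarrow> bool"
  where "quadratic_space scale B \<longleftrightarrow>
    bilinear_map scale (*) B \<and> (\<forall>x y. B x y = B y x) \<and> (\<forall>x. (\<forall>y. B x y = 0) \<longrightarrow> x = 0)"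

definition orthonormal_basis ::
  "(complex \<Rightarrow> 'g::ab_group_add \<Rightarrow> 'g) \<Rightarrow> ('g \<Rightarrow> 'g \<Rightarrow> complex) \<Rightarrow> 'g set \<Rightarrow> bool"
  where "orthonormal_basis scale B E \<longleftrightarrow>
    \<not> module.dependent scale E \<and> module.span scale E = UNIV \<and>
    (\<forall>x\<in>E. \<forall>y\<in>E. B x y = (if x = y then 1 else 0))"

text \<open>An element of the exterior algebra, being a finite sum of skew symmetric \<open>p\<close>-linear forms
  for various \<open>p\<close>, is encoded as a single function on lists of vectors: its degree \<open>p\<close> component
  is its restriction to the lists of length \<open>p\<close>. In particular \<open>1\<close> is the function that is
  \<open>1\<close> on the empty list and \<open>0\<close> elsewhere.\<close>

definition ext_power :: "(complex \<Rightarrow> 'g::ab_group_add \<Rightarrow> 'g) \<Rightarrow> nat \<Rightarrow> ('g list \<Rightarrow> complex) set"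
  where "ext_power scale p = {\<Omega>.
    (\<forall>ys. length ys \<noteq> p \<longrightarrow> \<Omega> ys = 0) \<and>
    (\<forall>ys i. length ys = p \<longrightarrow> i < p \<longrightarrow> Vector_Spaces.linear scale (*) (\<lambda>x. \<Omega> (ys[i := x]))) \<and>
    (\<forall>ys \<sigma>. length ys = p \<longrightarrow> \<sigma> permutes {..<p} \<longrightarrow>
       \<Omega> (permute_list \<sigma> ys) = of_int (sign \<sigma>) * \<Omega> ys)}"

definition hom_part :: "nat \<Rightarrow> ('g list \<Rightarrow> complex) \<Rightarrow> 'g list \<Rightarrow> complex"
  where "hom_part p \<Omega> = (\<lambda>ys. if length ys = p then \<Omega> ys else 0)"

definition ext_algebra :: "(complex \<Rightarrow> 'g::ab_group_add \<Rightarrow> 'g) \<Rightarrow> ('g list \<Rightarrow> complex) set"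
  where "ext_algebra scale = {\<Omega>.
    (\<forall>p. hom_part p \<Omega> \<in> ext_power scale p) \<and> finite {p. hom_part p \<Omega> \<noteq> (\<lambda>_. 0)}}"

definition shuffle_perms :: "nat \<Rightarrow> nat \<Rightarrow> (nat \<Rightarrow> nat) set"
  where "shuffle_perms p n =
    {\<sigma>. \<sigma> permutes {..<n} \<and> strict_mono_on {..<p} \<sigma> \<and> strict_mono_on {p..<n} \<sigma>}"

text \<open>The sum over \<open>p\<close> extends the wedge product of homogeneous forms bilinearly: only
  the degree \<open>p\<close> component of the first factor contributes to the \<open>p\<close>-th summand.\<close>

definition wedge :: "('g list \<Rightarrow> complex) \<Rightarrow> ('g list \<Rightarrow> complex) \<Rightarrow> 'g list \<Rightarrow> complex"
  where "wedge \<Omega> \<Omega>' = (\<lambda>ys. \<Sum>p\<le>length ys. \<Sum>\<sigma>\<in>shuffle_perms p (length ys).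
    of_int (sign \<sigma>) * \<Omega> (take p (permute_list \<sigma> ys)) * \<Omega>' (drop p (permute_list \<sigma> ys)))"

text \<open>The degree \<open>0\<close> component of \<open>\<Omega>\<close> is never evaluated here, so \<open>1\<close> is sent to \<open>0\<close>.\<close>

definition interior :: "'g \<Rightarrow> ('g list \<Rightarrow> complex) \<Rightarrow> 'g list \<Rightarrow> complex"
  where "interior X \<Omega> = (\<lambda>ys. \<Omega> (X # ys))"

text \<open>The bracket is extended linearly in its first argument from homogeneous forms. That it does
  not depend on the orthonormal basis is part of lemma \<open>super_poisson_homogeneous\<close> below.\<close>

definition super_poisson ::
  "(complex \<Rightarrow> 'g::ab_group_add \<Rightarrow> 'g) \<Rightarrow> ('g \<Rightarrow> 'g \<Rightarrow> complex) \<Rightarrow>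
    ('g list \<Rightarrow> complex) \<Rightarrow> ('g list \<Rightarrow> complex) \<Rightarrow> 'g list \<Rightarrow> complex"
  where "super_poisson scale B \<Omega> \<Omega>' =
    (let E = (SOME E. orthonormal_basis scale B E) in
      (\<lambda>ys. \<Sum>w\<in>{w. hom_part w \<Omega> \<noteq> (\<lambda>_. 0)}.
        2 * (- 1) ^ (w + 1) * (\<Sum>X\<in>E. wedge (interior X (hom_part w \<Omega>)) (interior X \<Omega>') ys)))"

definition ad_P ::
  "(complex \<Rightarrow> 'g::ab_group_add \<Rightarrow> 'g) \<Rightarrow> ('g \<Rightarrow> 'g \<Rightarrow> complex) \<Rightarrow>
    ('g list \<Rightarrow> complex) \<Rightarrow> ('g list \<Rightarrow> complex) \<Rightarrow> 'g list \<Rightarrow> complex"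
  where "ad_P scale B \<Omega> = (\<lambda>\<Omega>'. super_poisson scale B \<Omega> \<Omega>')"

definition skew_bilinear :: "(complex \<Rightarrow> 'g::ab_group_add \<Rightarrow> 'g) \<Rightarrow> ('g \<Rightarrow> 'g \<Rightarrow> 'g) \<Rightarrow> bool"
  where "skew_bilinear scale F \<longleftrightarrow> bilinear_map scale scale F \<and> (\<forall>x y. F x y = - F y x)"

definition associated_map ::
  "(complex \<Rightarrow> 'g::ab_group_add \<Rightarrow> 'g) \<Rightarrow> (('g list \<Rightarrow> complex) \<Rightarrow> 'g list \<Rightarrow> complex) \<Rightarrow> 'g \<Rightarrow> 'g \<Rightarrow> 'g"
  where "associated_map scale D = (THE F. skew_bilinear scale F \<and>
    (\<forall>\<omega>\<in>ext_power scale 1. \<forall>Y Z. D \<omega> [Y, Z] = - \<omega> [F Y Z]))"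

definition lie_structure :: "(complex \<Rightarrow> 'g::ab_group_add \<Rightarrow> 'g) \<Rightarrow> ('g \<Rightarrow> 'g \<Rightarrow> 'g) \<Rightarrow> bool"
  where "lie_structure scale F \<longleftrightarrow> bilinear_map scale scale F \<and> (\<forall>x. F x x = 0) \<and>
    (\<forall>x y z. F x (F y z) + F y (F z x) + F z (F x y) = 0)"

definition invariant_form :: "('g \<Rightarrow> 'g \<Rightarrow> 'g) \<Rightarrow> ('g \<Rightarrow> 'g \<Rightarrow> complex) \<Rightarrow> bool"
  where "invariant_form F B \<longleftrightarrow> (\<forall>x y z. B (F x y) z = - B y (F x z))"

definition quadratic_lie_algebra ::
  "(complex \<Rightarrow> 'g::ab_group_add \<Rightarrow> 'g) \<Rightarrow> ('g \<Rightarrow> 'g \<Rightarrow> 'g) \<Rightarrow> ('g \<Rightarrow> 'g \<Rightarrow> complex) \<Rightarrow> bool"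
  where "quadratic_lie_algebra scale F B \<longleftrightarrow>
    lie_structure scale F \<and> quadratic_space scale B \<and> invariant_form F B"

lemma bilinear_mapD:
  assumes "bilinear_map s t f"
  shows "f (x + x') y = f x y + f x' y" "f y (x + x') = f y x + f y x'"
    "f (s c x) y = t c (f x y)" "f x (s c y) = t c (f x y)"
proof -
  have l: "Vector_Spaces.linear s t (\<lambda>y. f x y)" "Vector_Spaces.linear s t (\<lambda>x. f x y)" for x y
    using assms by (auto simp: bilinear_map_def)
  show "f (x + x') y = f x y + f x' y"
    by (rule module_hom.add[OF Vector_Spaces.linear.axioms(3)[OF l(2)]])
  show "f y (x + x') = f y x + f y x'"
    by (rule module_hom.add[OF Vector_Spaces.linear.axioms(3)[OF l(1)]])
  show "f (s c x) y = t c (f x y)"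
    by (rule module_hom.scale[OF Vector_Spaces.linear.axioms(3)[OF l(2)]])
  show "f x (s c y) = t c (f x y)"
    by (rule module_hom.scale[OF Vector_Spaces.linear.axioms(3)[OF l(1)]])
qed

lemma bilinear_map_sum:
  assumes "bilinear_map s t f"
  shows "f (\<Sum>i\<in>A. g i) y = (\<Sum>i\<in>A. f (g i) y)" "f y (\<Sum>i\<in>A. g i) = (\<Sum>i\<in>A. f y (g i))"
proof -
  have l: "Vector_Spaces.linear s t (\<lambda>y. f x y)" "Vector_Spaces.linear s t (\<lambda>x. f x y)" for x y
    using assms by (auto simp: bilinear_map_def)
  show "f (\<Sum>i\<in>A. g i) y = (\<Sum>i\<in>A. f (g i) y)"
    by (rule module_hom.sum[OF Vector_Spaces.linear.axioms(3)[OF l(2)]])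
  show "f y (\<Sum>i\<in>A. g i) = (\<Sum>i\<in>A. f y (g i))"
    by (rule module_hom.sum[OF Vector_Spaces.linear.axioms(3)[OF l(1)]])
qed

lemma bilinear_map_zero_diff:
  assumes "bilinear_map s t f"
  shows "f 0 y = 0" "f y 0 = 0" "f (x - x') y = f x y - f x' y" "f y (x - x') = f y x - f y x'"
proof -
  have l: "Vector_Spaces.linear s t (\<lambda>y. f x y)" "Vector_Spaces.linear s t (\<lambda>x. f x y)" for x y
    using assms by (auto simp: bilinear_map_def)
  show "f 0 y = 0"
    by (rule module_hom.zero[OF Vector_Spaces.linear.axioms(3)[OF l(2)]])
  show "f y 0 = 0"
    by (rule module_hom.zero[OF Vector_Spaces.linear.axioms(3)[OF l(1)]])
  show "f (x - x') y = f x y - f x' y"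
    by (rule module_hom.diff[OF Vector_Spaces.linear.axioms(3)[OF l(2)]])
  show "f y (x - x') = f y x - f y x'"
    by (rule module_hom.diff[OF Vector_Spaces.linear.axioms(3)[OF l(1)]])
qed

lemma orthonormal_independent:
  assumes vs: "vector_space scale" and q: "quadratic_space scale B"
    and on: "\<forall>x\<in>E. \<forall>y\<in>E. B x y = (if x = y then 1 else 0)"
  shows "\<not> module.dependent scale E"
proof
  interpret vector_space scale by (rule vs)
  have b: "bilinear_map scale (*) B" using q by (simp add: quadratic_space_def)
  assume "dependent E"
  then obtain t u v where t: "finite t" "t \<subseteq> E" "(\<Sum>v\<in>t. scale (u v) v) = 0" "v \<in> t" "u v \<noteq> 0"
    unfolding dependent_explicit by blast
  have "0 = B (\<Sum>w\<in>t. scale (u w) w) v" by (simp add: t bilinear_map_zero_diff[OF b])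
  also have "\<dots> = (\<Sum>w\<in>t. u w * B w v)" by (simp add: bilinear_map_sum[OF b] bilinear_mapD[OF b])
  also have "\<dots> = (\<Sum>w\<in>t. if w = v then u v else 0)"
    using on subsetD[OF t(2)] t(4) by (intro sum.cong) auto
  also have "\<dots> = u v" using t by simp
  finally show False using t by simp
qed

lemma orthonormal_basis_exists:
  assumes fd: "finite_dimensional_vector_space scale Basis" and q: "quadratic_space scale B"
  shows "\<exists>E. orthonormal_basis scale B E"
proof -
  interpret finite_dimensional_vector_space scale Basis by (rule fd)
  have b: "bilinear_map scale (*) B" and sym: "\<And>x y. B x y = B y x"
    and nd: "\<And>x. (\<And>y. B x y = 0) \<Longrightarrow> x = 0"
    using q by (auto simp: quadratic_space_def)
  define P where "P E \<longleftrightarrow> (\<forall>x\<in>E. \<forall>y\<in>E. B x y = (if x = y then 1 else 0))" for E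
  have ind: "independent E" if "P E" for E
    using orthonormal_independent[OF vector_space_axioms q, of E] that P_def by blast
  have fin: "finite E" if "P E" for E using ind[OF that] finiteI_independent by blast
  have "P {}" by (simp add: P_def)
  moreover have "\<forall>E. P E \<longrightarrow> card E < Suc (dim UNIV)"
    using ind independent_card_le_dim[of _ UNIV] by (simp add: less_Suc_eq_le)
  ultimately have "\<exists>E. P E \<and> (\<forall>E'. P E' \<longrightarrow> card E' \<le> card E)"
    by (rule ex_has_greatest_nat)
  then obtain E where E: "P E" and max: "\<And>E'. P E' \<Longrightarrow> card E' \<le> card E"
    by blast
  note bs = bilinear_mapD[OF b] bilinear_map_sum[OF b] bilinear_map_zero_diff[OF b]
  define W where "W = {x. \<forall>e\<in>E. B e x = 0}"
  have iso: "B w w = 0" if "w \<in> W" for w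
  proof (rule ccontr)
    assume nz: "B w w \<noteq> 0"
    define v where "v = scale (1 / csqrt (B w w)) w"
    have "csqrt (B w w) * csqrt (B w w) = B w w" by (metis power2_csqrt power2_eq_square)
    then have v1: "B v v = 1" using nz by (simp add: v_def bs)
    have v0: "B e v = 0" if "e \<in> E" for e using that \<open>w \<in> W\<close> by (simp add: v_def bs W_def)
    have notin: "v \<notin> E" using v0 v1 by force
    have v0': "B v e = 0" if "e \<in> E" for e using v0[OF that] sym by metis
    have "e \<noteq> v" "v \<noteq> e" if "e \<in> E" for e using that notin by auto
    then have "P (insert v E)"
      using E v0 v0' v1 unfolding P_def by simp
    from max[OF this] show False using notin fin[OF E] by simp
  qed
  have iso2: "B x y = 0" if "x \<in> W" "y \<in> W" for x y
  proof -
    have "x + y \<in> W" using that by (simp add: W_def bs)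
    from iso[OF this] have "B x x + B x y + (B y x + B y y) = 0" by (simp add: bs add_ac)
    then have "2 * B x y = 0" by (simp add: iso[OF that(1)] iso[OF that(2)] sym[of y x])
    then show ?thesis by simp
  qed
  have proj: "x - (\<Sum>e\<in>E. scale (B e x) e) \<in> W" for x
  proof -
    have "B f (\<Sum>e\<in>E. scale (B e x) e) = B f x" if "f \<in> E" for f
    proof -
      have "B f (\<Sum>e\<in>E. scale (B e x) e) = (\<Sum>e\<in>E. B e x * B f e)" by (simp add: bs)
      also have "\<dots> = (\<Sum>e\<in>E. if e = f then B f x else 0)"
        using that E by (intro sum.cong) (auto simp: P_def)
      finally show ?thesis using that fin[OF E] by simp
    qed
    then show ?thesis by (simp add: W_def bs)
  qed
  have triv: "w = 0" if w: "w \<in> W" for w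
  proof (rule nd)
    fix y
    have "B w (\<Sum>e\<in>E. scale (B e y) e) = 0"
      using w by (simp add: bs W_def sym[of w _])
    moreover have "B w (y - (\<Sum>e\<in>E. scale (B e y) e)) = 0" using iso2[OF w proj] .
    ultimately show "B w y = 0" by (simp add: bs)
  qed
  have "x \<in> span E" for x
  proof -
    have "x = (\<Sum>e\<in>E. scale (B e x) e)" using triv[OF proj[of x]] by (rule eq_iff_diff_eq_0[THEN iffD2])
    also have "\<dots> \<in> span E" by (intro span_sum span_scale span_base)
    finally show ?thesis .
  qed
  then have "orthonormal_basis scale B E"
    using E ind[OF E] by (auto simp: orthonormal_basis_def P_def)
  then show ?thesis ..
qed

lemma orthonormal_basis_expand:
  assumes fd: "finite_dimensional_vector_space scale Basis" and q: "quadratic_space scale B"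
    and E: "orthonormal_basis scale B E"
  shows "finite E" and "x = (\<Sum>e\<in>E. scale (B e x) e)"
proof -
  interpret finite_dimensional_vector_space scale Basis by (rule fd)
  have b: "bilinear_map scale (*) B" using q by (auto simp: quadratic_space_def)
  note bs = bilinear_mapD[OF b] bilinear_map_sum[OF b] bilinear_map_zero_diff[OF b]
  show fin: "finite E" using E finiteI_independent by (auto simp: orthonormal_basis_def)
  have "x \<in> span E" using E by (simp add: orthonormal_basis_def)
  then obtain u where u: "x = (\<Sum>e\<in>E. scale (u e) e)"
    using span_finite[OF fin] by auto
  have "B f x = u f" if "f \<in> E" for f
  proof -
    have "B f x = (\<Sum>e\<in>E. u e * B f e)" by (simp add: u bs)
    also have "\<dots> = (\<Sum>e\<in>E. if e = f then u f else 0)"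
      using that E by (intro sum.cong) (auto simp: orthonormal_basis_def)
    finally show ?thesis using that fin by simp
  qed
  then have "(\<Sum>e\<in>E. scale (u e) e) = (\<Sum>e\<in>E. scale (B e x) e)"
    by (intro sum.cong) auto
  with u show "x = (\<Sum>e\<in>E. scale (B e x) e)" by (rule trans)
qed

lemma orthonormal_sum_independent:
  assumes fd: "finite_dimensional_vector_space scale Basis" and q: "quadratic_space scale B"
    and E: "orthonormal_basis scale B E" and G: "orthonormal_basis scale B G"
    and f: "bilinear_map scale (*) f"
  shows "(\<Sum>x\<in>E. f x x) = (\<Sum>x\<in>G. (f x x :: complex))"
proof -
  have b: "bilinear_map scale (*) B" and sym: "\<And>x y. B x y = B y x"
    using q by (auto simp: quadratic_space_def)
  note bs = bilinear_mapD[OF b] bilinear_map_sum[OF b]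
  note fs = bilinear_mapD[OF f] bilinear_map_sum[OF f]
  note fin = orthonormal_basis_expand(1)[OF fd q E] orthonormal_basis_expand(1)[OF fd q G]
  have d: "(\<Sum>e\<in>E. B x e * B y e) = B x y" for x y
  proof -
    have "B x y = B x (\<Sum>e\<in>E. scale (B e y) e)"
      by (rule arg_cong[OF orthonormal_basis_expand(2)[OF fd q E, of y]])
    also have "\<dots> = (\<Sum>e\<in>E. B x e * B y e)" by (simp add: bs sym[of _ y] mult.commute)
    finally show ?thesis by simp
  qed
  have "f e e = (\<Sum>x\<in>G. \<Sum>y\<in>G. B x e * B y e * f x y)" for e
  proof -
    have "f e e = f (\<Sum>x\<in>G. scale (B x e) x) (\<Sum>y\<in>G. scale (B y e) y)"
      by (rule arg_cong2[OF orthonormal_basis_expand(2)[OF fd q G, of e]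
          orthonormal_basis_expand(2)[OF fd q G, of e]])
    also have "\<dots> = (\<Sum>x\<in>G. \<Sum>y\<in>G. f (scale (B x e) x) (scale (B y e) y))"
      by (subst fs(5)) (simp only: fs(6))
    also have "\<dots> = (\<Sum>x\<in>G. \<Sum>y\<in>G. B x e * B y e * f x y)"
      by (simp only: fs(3,4) mult.assoc mult.left_commute)
    finally show ?thesis .
  qed
  then have "(\<Sum>e\<in>E. f e e) = (\<Sum>e\<in>E. \<Sum>x\<in>G. \<Sum>y\<in>G. B x e * B y e * f x y)" by simp
  also have "\<dots> = (\<Sum>x\<in>G. \<Sum>e\<in>E. \<Sum>y\<in>G. B x e * B y e * f x y)" by (rule sum.swap)
  also have "\<dots> = (\<Sum>x\<in>G. \<Sum>y\<in>G. \<Sum>e\<in>E. B x e * B y e * f x y)"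
    by (intro sum.cong refl sum.swap)
  also have "\<dots> = (\<Sum>x\<in>G. \<Sum>y\<in>G. B x y * f x y)"
    by (simp add: d flip: sum_distrib_right)
  also have "\<dots> = (\<Sum>x\<in>G. \<Sum>y\<in>G. if x = y then f x x else 0)"
    using G by (intro sum.cong) (auto simp: orthonormal_basis_def)
  also have "\<dots> = (\<Sum>x\<in>G. f x x)" using fin by simp
  finally show ?thesis .
qed

lemma interior_linear:
  assumes vs: "vector_space scale" and \<Omega>: "\<Omega> \<in> ext_algebra scale"
  shows "Vector_Spaces.linear scale (*) (\<lambda>X. interior X \<Omega> ys)"
proof -
  have "hom_part (Suc (length ys)) \<Omega> \<in> ext_power scale (Suc (length ys))"
    using \<Omega> by (simp add: ext_algebra_def)
  then have "\<forall>zs i. length zs = Suc (length ys) \<longrightarrow> i < Suc (length ys) \<longrightarrow>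
      Vector_Spaces.linear scale (*) (\<lambda>x. hom_part (Suc (length ys)) \<Omega> (zs[i := x]))"
    by (simp add: ext_power_def)
  from this[rule_format, of "0 # ys" 0] show ?thesis by (simp add: hom_part_def interior_def)
qed

lemma hom_part_ext_power:
  assumes "\<Omega> \<in> ext_power scale w"
  shows "hom_part p \<Omega> = (if p = w then \<Omega> else (\<lambda>_. 0))"
  using assms by (auto simp: ext_power_def hom_part_def fun_eq_iff)

lemma zero_in_ext_power:
  assumes "vector_space scale"
  shows "(\<lambda>_. 0) \<in> ext_power scale p"
proof -
  interpret vector_space scale by (rule assms)
  have "Vector_Spaces.linear scale ((*) :: complex \<Rightarrow> complex \<Rightarrow> complex) (\<lambda>_. 0)"
    by unfold_locales (auto simp: algebra_simps)
  then show ?thesis by (simp add: ext_power_def)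
qed

lemma ext_power_subset_ext_algebra:
  assumes "vector_space scale"
  shows "ext_power scale w \<subseteq> ext_algebra scale"
proof
  fix \<Omega> assume \<Omega>: "\<Omega> \<in> ext_power scale w"
  have "{p. hom_part p \<Omega> \<noteq> (\<lambda>_. 0)} \<subseteq> {w}" by (auto simp: hom_part_ext_power[OF \<Omega>])
  then show "\<Omega> \<in> ext_algebra scale"
    using \<Omega> zero_in_ext_power[OF assms] finite_subset[of _ "{w}"]
    by (auto simp: ext_algebra_def hom_part_ext_power[OF \<Omega>])
qed

lemma wedge_interior_bilinear:
  assumes vs: "vector_space scale" and \<Omega>: "\<Omega> \<in> ext_algebra scale" "\<Omega>' \<in> ext_algebra scale"
  shows "bilinear_map scale (*) (\<lambda>X Y. wedge (interior X \<Omega>) (interior Y \<Omega>') ys)"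
proof -
  interpret vector_space scale by (rule vs)
  note l = Vector_Spaces.linear.axioms(3)[OF interior_linear[OF vs \<Omega>(1)]] Vector_Spaces.linear.axioms(3)[OF interior_linear[OF vs \<Omega>(2)]]
  note s = module_hom.add[OF l(1)] module_hom.add[OF l(2)] module_hom.scale[OF l(1)] module_hom.scale[OF l(2)]
  show ?thesis
    unfolding bilinear_map_def
    by (intro conjI allI; unfold_locales)
      (simp_all add: wedge_def s algebra_simps sum.distrib sum_distrib_left)
qed

lemma super_poisson_homogeneous:
  assumes fd: "finite_dimensional_vector_space scale Basis" and q: "quadratic_space scale B"
    and \<Omega>: "\<Omega> \<in> ext_power scale w" and \<Omega>': "\<Omega>' \<in> ext_algebra scale"
    and E: "orthonormal_basis scale B E"
  shows "super_poisson scale B \<Omega> \<Omega>' =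
    (\<lambda>ys. 2 * (- 1) ^ (w + 1) * (\<Sum>X\<in>E. wedge (interior X \<Omega>) (interior X \<Omega>') ys))"
proof
  fix ys
  have vs: "vector_space scale" using fd by (simp add: finite_dimensional_vector_space_def)
  define G where "G = (SOME E. orthonormal_basis scale B E)"
  have G: "orthonormal_basis scale B G"
    unfolding G_def by (rule someI[of _ E]) (rule E)
  have "(\<Sum>X\<in>G. wedge (interior X \<Omega>) (interior X \<Omega>') ys) = (\<Sum>X\<in>E. wedge (interior X \<Omega>) (interior X \<Omega>') ys)"
    using orthonormal_sum_independent[OF fd q G E wedge_interior_bilinear[OF vs _ \<Omega>']]
      ext_power_subset_ext_algebra[OF vs] \<Omega> by blast
  moreover have "{p. hom_part p \<Omega> \<noteq> (\<lambda>_. 0)} = (if \<Omega> = (\<lambda>_. 0) then {} else {w})"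
    by (auto simp: hom_part_ext_power[OF \<Omega>])
  moreover have "wedge (interior X (\<lambda>_. 0)) (interior X \<Omega>') ys = 0" for X
    by (simp add: wedge_def interior_def)
  ultimately show "super_poisson scale B \<Omega> \<Omega>' ys =
      2 * (- 1) ^ (w + 1) * (\<Sum>X\<in>E. wedge (interior X \<Omega>) (interior X \<Omega>') ys)"
    by (auto simp: super_poisson_def hom_part_ext_power[OF \<Omega>] simp flip: G_def)
qed

end

(* Contracting I with an orthonormal basis E gives F Y Z = \<Sum>X\<in>E. I(X,Y,Z) X, so that
   I(X,Y,Z) = B (F X Y) Z holds for every I, without the Jacobi identity. The six (2,2)-shuffles
   then turn {I,I}(a,b,c,d) into 4 B(a, J(b,c,d)), where J is the Jacobiator of F, and B is
   non degenerate. *)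
theory Submission
  imports Defs
begin

section \<open>Skew symmetric forms of degree one and three, evaluated on explicit lists\<close>

lemma ext_power_linear:
  assumes "\<Omega> \<in> ext_power scale p" "length ys = p" "i < p"
  shows "Vector_Spaces.linear scale (*) (\<lambda>x. \<Omega> (ys[i := x]))"
  using assms by (simp add: ext_power_def)

lemma ext_power_transpose:
  assumes "\<Omega> \<in> ext_power scale p" "length ys = p" "i < p" "j < p" "i \<noteq> j"
  shows "\<Omega> (permute_list (transpose i j) ys) = - \<Omega> ys"
proof -
  have "transpose i j permutes {..<p}"
    using assms by (intro permutes_swap_id) auto
  then show ?thesis
    using assms by (auto simp: ext_power_def sign_swap_id)
qed

lemma permute_list_swap_3:
  "permute_list (transpose 0 (Suc 0)) [x, y, z] = [y, x, z]"
  "permute_list (transpose (Suc 0) 2) [x, y, z] = [x, z, y]"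
  by (simp_all add: permute_list_def upt_rec transpose_def)

text \<open>The two adjacent transpositions generate all permutations of three arguments, so these
  rules suffice for every later rearrangement of \<open>I\<close>.\<close>

lemma ext_power_3_skew:
  assumes "I \<in> ext_power scale 3"
  shows "I [y, x, z] = - I [x, y, z]" "I [x, z, y] = - I [x, y, z]"
  using ext_power_transpose[OF assms, of "[x, y, z]" 0 "Suc 0"]
    ext_power_transpose[OF assms, of "[x, y, z]" "Suc 0" 2]
  by (simp_all add: permute_list_swap_3)

lemma ext_power_3_linear:
  assumes "I \<in> ext_power scale 3"
  shows "Vector_Spaces.linear scale (*) (\<lambda>x. I [x, y, z])"
    "Vector_Spaces.linear scale (*) (\<lambda>x. I [y, x, z])"
    "Vector_Spaces.linear scale (*) (\<lambda>x. I [y, z, x])"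
  \<comment> \<open>The entry at the updated position of each list is a dummy: the update overwrites
    it.\<close>
  using ext_power_linear[OF assms, of "[y, y, z]" 0] ext_power_linear[OF assms, of "[y, y, z]" 1]
    ext_power_linear[OF assms, of "[y, z, z]" 2]
  by (simp_all add: numeral_2_eq_2)

lemma ext_power_1_linear:
  assumes "\<omega> \<in> ext_power scale 1"
  shows "Vector_Spaces.linear scale (*) (\<lambda>x. \<omega> [x])"
  using ext_power_linear[OF assms, of "[0]" 0] by simp

text \<open>Turns the linear forms \<open>B _ W\<close> into elements of degree one, which serve as
  test covectors for \<open>associated_map\<close>. Skew symmetry is automatic, as the identity is
  the only permutation of one index.\<close>

lemma linear_form_in_ext_power_1:
  assumes "Vector_Spaces.linear scale (*) f"
  shows "(\<lambda>ys. if length ys = 1 then f (hd ys) else 0) \<in> ext_power scale 1"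
proof -
  have "permute_list \<sigma> ys = ys \<and> sign \<sigma> = 1" if "\<sigma> permutes {..<Suc 0}"
    for \<sigma> and ys :: "'a list"
    using that by (simp add: lessThan_Suc)
  moreover have "hd (ys[0 := x]) = x" if "length ys = Suc 0" for ys :: "'a list" and x
    using that by (cases ys) auto
  ultimately show ?thesis
    using assms by (auto simp: ext_power_def)
qed

section \<open>Shuffles and wedge products in low degree\<close>

lemma wedge_homogeneous:
  assumes "\<And>ys. length ys \<noteq> p \<Longrightarrow> \<Omega> ys = 0" "\<And>ys. length ys \<noteq> q \<Longrightarrow> \<Omega>' ys = 0"
  shows "wedge \<Omega> \<Omega>' ys = (if length ys = p + q then \<Sum>\<sigma>\<in>shuffle_perms p (length ys).
    of_int (sign \<sigma>) * \<Omega> (take p (permute_list \<sigma> ys)) * \<Omega>' (drop p (permute_list \<sigma> ys)) else 0)"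
proof -
  define S where "S r = (\<Sum>\<sigma>\<in>shuffle_perms r (length ys).
    of_int (sign \<sigma>) * \<Omega> (take r (permute_list \<sigma> ys)) * \<Omega>' (drop r (permute_list \<sigma> ys)))" for r
  \<comment> \<open>Since \<open>r \<le> length ys\<close>, the first factor sees a list of length
    exactly \<open>r\<close> and dies unless \<open>r = p\<close>. For \<open>r = p\<close> in the
    wrong total degree, the rest has length different from \<open>q\<close> and the second factor
    dies.\<close>
  have S0: "S r = 0" if "r \<noteq> p \<or> length ys \<noteq> p + q" "r \<le> length ys" for r
  proof (cases "r = p")
    case True
    then have "\<Omega>' (drop r (permute_list \<sigma> ys)) = 0" for \<sigma>
      using that by (intro assms) auto
    then show ?thesis by (simp add: S_def)
  next
    case False
    then have "\<Omega> (take r (permute_list \<sigma> ys)) = 0" for \<sigma>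
      using that by (intro assms) auto
    then show ?thesis by (simp add: S_def)
  qed
  show ?thesis
  proof (cases "length ys = p + q")
    case True
    have "(\<Sum>r\<le>length ys. S r) = (\<Sum>r\<in>{p}. S r)"
      using True by (intro sum.mono_neutral_right) (auto intro: S0)
    then show ?thesis by (simp add: wedge_def S_def True)
  next
    case False
    then show ?thesis
      unfolding wedge_def S_def[symmetric] by (auto intro!: sum.neutral S0)
  qed
qed

text \<open>With an empty second block a shuffle is increasing on the whole range, hence
  \<open>j \<le> \<sigma> j\<close> throughout. A permutation preserves the sum of all indices, so
  no inequality can be strict.\<close>

lemma shuffle_perms_refl: "shuffle_perms n n = {id}"
proof -
  have "\<sigma> = id" if \<sigma>: "\<sigma> permutes {..<n}" and mono: "strict_mono_on {..<n} \<sigma>" for \<sigma>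
  proof
    fix i
    have le: "j \<le> \<sigma> j" if "j < n" for j
      using that
    proof (induction j)
      case (Suc j)
      then have "\<sigma> j < \<sigma> (Suc j)" using mono by (auto simp: strict_mono_on_def)
      with Suc show ?case by simp
    qed simp
    show "\<sigma> i = id i"
    proof (cases "i < n")
      case True
      have eq: "(\<Sum>j<n. \<sigma> j) = (\<Sum>j<n. j)"
        using sum.permute[OF \<sigma>, of id] by simp
      show ?thesis
      proof (rule ccontr)
        assume "\<sigma> i \<noteq> id i"
        then have "i < \<sigma> i" using le[OF True] by simp
        then have "(\<Sum>j<n. j) < (\<Sum>j<n. \<sigma> j)"
          using True le by (intro sum_strict_mono_ex1) auto
        with eq show False by simp
      qed
    qed (use \<sigma> in \<open>auto simp: permutes_def\<close>)
  qed
  then show ?thesis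
    by (auto simp: shuffle_perms_def permutes_id strict_mono_on_def)
qed

text \<open>Products of transpositions are chosen as normal forms so that the signs can be computed
  factor by factor.\<close>

lemma shuffle_perms_2_4:
  "shuffle_perms 2 4 =
    {id, transpose 1 2, transpose 2 3 \<circ> transpose 1 2, transpose 0 1 \<circ> transpose 1 2,
     transpose 2 3 \<circ> (transpose 0 1 \<circ> transpose 1 2), transpose 0 2 \<circ> transpose 1 3}"
  (is "_ = ?R")
proof
  show "shuffle_perms 2 4 \<subseteq> ?R"
  proof
    fix \<sigma> assume "\<sigma> \<in> shuffle_perms 2 4"
    then have \<sigma>: "\<sigma> permutes {..<4}" and m: "strict_mono_on {..<2} \<sigma>" "strict_mono_on {2..<4} \<sigma>"
      by (auto simp: shuffle_perms_def)
    have lt: "\<sigma> 0 < \<sigma> 1" "\<sigma> 2 < \<sigma> 3"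
      using m by (auto simp: strict_mono_on_def)
    have b: "\<sigma> 1 < 4" "\<sigma> 3 < 4"
      using permutes_in_image[OF \<sigma>] by auto
    have ne: "\<sigma> 0 \<noteq> \<sigma> 2" "\<sigma> 0 \<noteq> \<sigma> 3" "\<sigma> 1 \<noteq> \<sigma> 2" "\<sigma> 1 \<noteq> \<sigma> 3"
      by (simp_all add: inj_eq[OF permutes_inj[OF \<sigma>]])
    have out: "\<sigma> x = x" if "x \<ge> 4" for x
      using \<sigma> that by (auto simp: permutes_def)
    have eqI: "\<sigma> = \<tau>" if "\<sigma> 0 = \<tau> 0" "\<sigma> 1 = \<tau> 1" "\<sigma> 2 = \<tau> 2" "\<sigma> 3 = \<tau> 3" "\<And>x. x \<ge> 4 \<Longrightarrow> \<tau> x = x" for \<tau>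
    proof
      fix x :: nat
      consider "x = 0" | "x = 1" | "x = 2" | "x = 3" | "x \<ge> 4" by linarith
      then show "\<sigma> x = \<tau> x" using that out by cases auto
    qed
    \<comment> \<open>A shuffle is determined by the pair of values on its first block, which leaves
      the six two-element subsets of four indices.\<close>
    have "(\<sigma> 0 = 0 \<and> \<sigma> 1 = 1 \<and> \<sigma> 2 = 2 \<and> \<sigma> 3 = 3) \<or> (\<sigma> 0 = 0 \<and> \<sigma> 1 = 2 \<and> \<sigma> 2 = 1 \<and> \<sigma> 3 = 3) \<or>
        (\<sigma> 0 = 0 \<and> \<sigma> 1 = 3 \<and> \<sigma> 2 = 1 \<and> \<sigma> 3 = 2) \<or> (\<sigma> 0 = 1 \<and> \<sigma> 1 = 2 \<and> \<sigma> 2 = 0 \<and> \<sigma> 3 = 3) \<or>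
        (\<sigma> 0 = 1 \<and> \<sigma> 1 = 3 \<and> \<sigma> 2 = 0 \<and> \<sigma> 3 = 2) \<or> (\<sigma> 0 = 2 \<and> \<sigma> 1 = 3 \<and> \<sigma> 2 = 0 \<and> \<sigma> 3 = 1)"
      using lt b ne by presburger
    then show "\<sigma> \<in> ?R"
    proof (elim disjE)
      assume "\<sigma> 0 = 0 \<and> \<sigma> 1 = 1 \<and> \<sigma> 2 = 2 \<and> \<sigma> 3 = 3"
      then have "\<sigma> = id" by (intro eqI) auto
      then show ?thesis by simp
    next
      assume "\<sigma> 0 = 0 \<and> \<sigma> 1 = 2 \<and> \<sigma> 2 = 1 \<and> \<sigma> 3 = 3"
      then have "\<sigma> = transpose 1 2" by (intro eqI) (auto simp: transpose_def)
      then show ?thesis by simp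
    next
      assume "\<sigma> 0 = 0 \<and> \<sigma> 1 = 3 \<and> \<sigma> 2 = 1 \<and> \<sigma> 3 = 2"
      then have "\<sigma> = transpose 2 3 \<circ> transpose 1 2" by (intro eqI) (auto simp: transpose_def)
      then show ?thesis by simp
    next
      assume "\<sigma> 0 = 1 \<and> \<sigma> 1 = 2 \<and> \<sigma> 2 = 0 \<and> \<sigma> 3 = 3"
      then have "\<sigma> = transpose 0 1 \<circ> transpose 1 2" by (intro eqI) (auto simp: transpose_def)
      then show ?thesis by simp
    next
      assume "\<sigma> 0 = 1 \<and> \<sigma> 1 = 3 \<and> \<sigma> 2 = 0 \<and> \<sigma> 3 = 2"
      then have "\<sigma> = transpose 2 3 \<circ> (transpose 0 1 \<circ> transpose 1 2)"
        by (intro eqI) (auto simp: transpose_def)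
      then show ?thesis by simp
    next
      assume "\<sigma> 0 = 2 \<and> \<sigma> 1 = 3 \<and> \<sigma> 2 = 0 \<and> \<sigma> 3 = 1"
      then have "\<sigma> = transpose 0 2 \<circ> transpose 1 3" by (intro eqI) (auto simp: transpose_def)
      then show ?thesis by simp
    qed
  qed
next
  have mono: "strict_mono_on {..<2} \<sigma> \<longleftrightarrow> \<sigma> 0 < \<sigma> 1" "strict_mono_on {2..<4} \<sigma> \<longleftrightarrow> \<sigma> 2 < \<sigma> 3"
    for \<sigma> :: "nat \<Rightarrow> nat"
  proof -
    have "{..<2} = {0, 1::nat}" "{2..<4} = {2, 3::nat}" by auto
    then show "strict_mono_on {..<2} \<sigma> \<longleftrightarrow> \<sigma> 0 < \<sigma> 1" "strict_mono_on {2..<4} \<sigma> \<longleftrightarrow> \<sigma> 2 < \<sigma> 3"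
      by (auto simp: strict_mono_on_def)
  qed
  have tr: "transpose i j permutes {..<4}" if "i < 4" "j < 4" for i j :: nat
    using that by (intro permutes_swap_id) auto
  have "\<forall>\<sigma>\<in>?R. \<sigma> permutes {..<4}"
    by (simp add: tr permutes_compose permutes_id)
  moreover have "\<forall>\<sigma>\<in>?R. \<sigma> 0 < \<sigma> 1 \<and> \<sigma> 2 < \<sigma> 3"
    by (simp add: transpose_def)
  ultimately show "?R \<subseteq> shuffle_perms 2 4"
    unfolding shuffle_perms_def mono by blast
qed

lemma sum_shuffle_perms_2_4:
  fixes f :: "(nat \<Rightarrow> nat) \<Rightarrow> 'b::comm_monoid_add"
  shows "(\<Sum>\<sigma>\<in>shuffle_perms 2 4. f \<sigma>) =
    f id + f (transpose 1 2) + f (transpose 2 3 \<circ> transpose 1 2) +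
    f (transpose 0 1 \<circ> transpose 1 2) + f (transpose 2 3 \<circ> (transpose 0 1 \<circ> transpose 1 2)) +
    f (transpose 0 2 \<circ> transpose 1 3)"
proof -
  define L :: "(nat \<Rightarrow> nat) list" where
    "L = [id, transpose 1 2, transpose 2 3 \<circ> transpose 1 2, transpose 0 1 \<circ> transpose 1 2,
     transpose 2 3 \<circ> (transpose 0 1 \<circ> transpose 1 2), transpose 0 2 \<circ> transpose 1 3]"
  \<comment> \<open>The values at 0 and 1 already separate the six shuffles, which reduces
    inequality of functions to inequality of numerals.\<close>
  have "distinct (map (\<lambda>\<sigma>. (\<sigma> 0, \<sigma> 1)) L)"
    by (simp add: L_def transpose_def)
  then have "distinct L" by (simp only: distinct_map)
  moreover have "shuffle_perms 2 4 = set L"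
    by (simp only: L_def shuffle_perms_2_4 list.set)
  ultimately have "(\<Sum>\<sigma>\<in>shuffle_perms 2 4. f \<sigma>) = sum_list (map f L)"
    by (simp only: sum.distinct_set_conv_list)
  then show ?thesis by (simp add: L_def add_ac)
qed

lemma wedge_2_2:
  assumes "\<And>ys. length ys \<noteq> 2 \<Longrightarrow> \<Omega> ys = 0" "\<And>ys. length ys \<noteq> 2 \<Longrightarrow> \<Omega>' ys = 0"
  shows "wedge \<Omega> \<Omega>' [a, b, c, d] =
    \<Omega> [a, b] * \<Omega>' [c, d] - \<Omega> [a, c] * \<Omega>' [b, d] + \<Omega> [a, d] * \<Omega>' [b, c] +
    \<Omega> [b, c] * \<Omega>' [a, d] - \<Omega> [b, d] * \<Omega>' [a, c] + \<Omega> [c, d] * \<Omega>' [a, b]"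
proof -
  \<comment> \<open>Each leading transposition flips the sign. The six shuffles have 0, 1, 2, 2, 3
    and 2 factors, which yields the sign pattern of the expansion.\<close>
  have sgn: "sign (transpose i j \<circ> \<sigma>) = - sign \<sigma>" if "i \<noteq> j" "permutation \<sigma>" for i j :: nat and \<sigma>
    using that by (simp add: sign_compose permutation_swap_id sign_swap_id)
  have perm: "permutation (transpose i j \<circ> transpose k l)" for i j k l :: nat
    by (intro permutation_compose permutation_swap_id)
  have "wedge \<Omega> \<Omega>' [a, b, c, d] = (\<Sum>\<sigma>\<in>shuffle_perms 2 4. of_int (sign \<sigma>) *
      \<Omega> (take 2 (permute_list \<sigma> [a, b, c, d])) * \<Omega>' (drop 2 (permute_list \<sigma> [a, b, c, d])))"
    using wedge_homogeneous[OF assms, where ys = "[a, b, c, d]"] by (simp add: numeral_eq_Suc)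
  then show ?thesis
    unfolding sum_shuffle_perms_2_4
    by (simp add: sgn perm permutation_swap_id sign_swap_id sign_id permute_list_def upt_rec
        transpose_def numeral_2_eq_2 numeral_3_eq_3)
qed

text \<open>This is the shape met in the bracket of \<open>I\<close> with a covector: contracting
  the covector leaves a scalar, stored as the value on the empty list.\<close>

lemma wedge_2_0:
  assumes "\<And>ys. length ys \<noteq> 2 \<Longrightarrow> \<Omega> ys = 0" "\<And>ys. ys \<noteq> [] \<Longrightarrow> \<Omega>' ys = 0"
  shows "wedge \<Omega> \<Omega>' [Y, Z] = \<Omega> [Y, Z] * \<Omega>' []"
proof -
  have "wedge \<Omega> \<Omega>' [Y, Z] = (\<Sum>\<sigma>\<in>shuffle_perms 2 2. of_int (sign \<sigma>) *
      \<Omega> (take 2 (permute_list \<sigma> [Y, Z])) * \<Omega>' (drop 2 (permute_list \<sigma> [Y, Z])))"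
    by (subst wedge_homogeneous[of 2 _ 0]) (simp_all add: assms numeral_2_eq_2)
  then show ?thesis by (simp add: shuffle_perms_refl sign_id)
qed

section \<open>The bilinear map associated with the derivation\<close>

lemma associated_map_eqI:
  assumes q: "quadratic_space scale B"
    and F: "skew_bilinear scale F"
    and D: "\<And>\<omega> Y Z. \<omega> \<in> ext_power scale 1 \<Longrightarrow> D \<omega> [Y, Z] = - \<omega> [F Y Z]"
  shows "associated_map scale D = F"
  unfolding associated_map_def
proof (rule the_equality)
  fix G assume G: "skew_bilinear scale G \<and>
    (\<forall>\<omega>\<in>ext_power scale 1. \<forall>Y Z. D \<omega> [Y, Z] = - \<omega> [G Y Z])"
  show "G = F"
  proof (intro ext)
    fix Y Z
    have b: "bilinear_map scale (*) B" using q by (simp add: quadratic_space_def)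
    \<comment> \<open>Two candidates agree under every covector, in particular under all
      \<open>B _ W\<close>. By nondegeneracy these separate vectors, so the description in
      \<open>associated_map\<close> picks out a single map.\<close>
    have "B (G Y Z - F Y Z) W = 0" for W
    proof -
      let ?\<omega> = "\<lambda>ys. if length ys = 1 then B (hd ys) W else 0"
      have "?\<omega> \<in> ext_power scale 1"
        using b by (intro linear_form_in_ext_power_1) (simp add: bilinear_map_def)
      then have "D ?\<omega> [Y, Z] = - ?\<omega> [F Y Z]" "D ?\<omega> [Y, Z] = - ?\<omega> [G Y Z]"
        using D G by blast+
      then have "- ?\<omega> [G Y Z] = - ?\<omega> [F Y Z]" by (rule trans[OF sym, rotated])
      then show ?thesis by (simp add: bilinear_map_zero_diff[OF b])
    qed
    then have "G Y Z - F Y Z = 0" using q unfolding quadratic_space_def by blast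
    then show "G Y Z = F Y Z" by simp
  qed
qed (use F D in auto)

text \<open>In degree 3 the sign of the bracket is \<open>(- 1) ^ 4 = 1\<close>, and each wedge
  collapses to multiplication by the scalar \<open>\<omega> [X]\<close>.\<close>

lemma super_poisson_3_1:
  assumes fd: "finite_dimensional_vector_space scale Basis" and q: "quadratic_space scale B"
    and E: "orthonormal_basis scale B E"
    and I: "I \<in> ext_power scale 3" and \<omega>: "\<omega> \<in> ext_power scale 1"
  shows "super_poisson scale B I \<omega> [Y, Z] = 2 * (\<Sum>X\<in>E. I [X, Y, Z] * \<omega> [X])"
proof -
  have vs: "vector_space scale" using fd by (simp add: finite_dimensional_vector_space_def)
  have \<omega>': "\<omega> \<in> ext_algebra scale" using ext_power_subset_ext_algebra[OF vs] \<omega> by blast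
  have "wedge (interior X I) (interior X \<omega>) [Y, Z] = I [X, Y, Z] * \<omega> [X]" for X
    using I \<omega> by (subst wedge_2_0) (auto simp: interior_def ext_power_def)
  then show ?thesis
    by (simp add: super_poisson_homogeneous[OF fd q I \<omega>' E])
qed

lemma associated_map_ad_P_3:
  assumes fd: "finite_dimensional_vector_space scale Basis" and q: "quadratic_space scale B"
    and E: "orthonormal_basis scale B E" and I: "I \<in> ext_power scale 3"
  shows "skew_bilinear scale (\<lambda>Y Z. \<Sum>X\<in>E. scale (I [X, Y, Z]) X)"
    and "associated_map scale (\<lambda>\<Omega> ys. - (1 / 2) * ad_P scale B I \<Omega> ys) =
      (\<lambda>Y Z. \<Sum>X\<in>E. scale (I [X, Y, Z]) X)"
proof -
  interpret finite_dimensional_vector_space scale Basis by (rule fd)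
  let ?F = "\<lambda>Y Z. \<Sum>X\<in>E. scale (I [X, Y, Z]) X"
  note l = Vector_Spaces.linear.axioms(3)[OF ext_power_3_linear(2)[OF I]]
    Vector_Spaces.linear.axioms(3)[OF ext_power_3_linear(3)[OF I]]
  note s = module_hom.add[OF l(1)] module_hom.add[OF l(2)]
    module_hom.scale[OF l(1)] module_hom.scale[OF l(2)]
  have "bilinear_map scale scale ?F"
    unfolding bilinear_map_def
    by (intro conjI allI; unfold_locales)
      (simp_all add: s scale_left_distrib sum.distrib scale_sum_right)
  moreover have "?F Y Z = - ?F Z Y" for Y Z
    by (simp add: ext_power_3_skew(2)[OF I, of _ Y Z] sum_negf)
  ultimately show F: "skew_bilinear scale ?F"
    unfolding skew_bilinear_def by blast
  show "associated_map scale (\<lambda>\<Omega> ys. - (1 / 2) * ad_P scale B I \<Omega> ys) = ?F"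
  proof (rule associated_map_eqI[OF q F])
    fix \<omega> Y Z assume \<omega>: "\<omega> \<in> ext_power scale 1"
    note m = Vector_Spaces.linear.axioms(3)[OF ext_power_1_linear[OF \<omega>]]
    \<comment> \<open>The normalisation \<open>- (1 / 2)\<close> cancels the factor 2 of the bracket
      and supplies the required minus sign. Linearity of \<open>\<omega>\<close> then moves the sum
      over \<open>E\<close> inside its argument.\<close>
    show "- (1 / 2) * ad_P scale B I \<omega> [Y, Z] = - \<omega> [?F Y Z]"
      by (simp add: ad_P_def super_poisson_3_1[OF fd q E I \<omega>] module_hom.sum[OF m] module_hom.scale[OF m])
  qed
qed

section \<open>The bracket of \<open>I\<close> with itself and the Jacobi identity\<close>

lemma super_poisson_3_3:
  assumes fd: "finite_dimensional_vector_space scale Basis" and q: "quadratic_space scale B"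
    and E: "orthonormal_basis scale B E" and I: "I \<in> ext_power scale 3"
  shows "super_poisson scale B I I ys =
    (if length ys = 4 then 2 * (\<Sum>X\<in>E. wedge (interior X I) (interior X I) ys) else 0)"
proof -
  have vs: "vector_space scale" using fd by (simp add: finite_dimensional_vector_space_def)
  have I': "I \<in> ext_algebra scale" using ext_power_subset_ext_algebra[OF vs] I by blast
  have "wedge (interior X I) (interior X I) ys = 0" if "length ys \<noteq> 4" for X
    using I that by (subst wedge_homogeneous[of 2 _ 2]) (auto simp: interior_def ext_power_def)
  then show ?thesis
    by (simp add: super_poisson_homogeneous[OF fd q I I' E])
qed

theorem proposition5p6p1:
  fixes scale :: "complex \<Rightarrow> 'g::ab_group_add \<Rightarrow> 'g"
    and Basis :: "'g set"
    and B :: "'g \<Rightarrow> 'g \<Rightarrow> complex"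
    and I :: "'g list \<Rightarrow> complex"
    and D :: "('g list \<Rightarrow> complex) \<Rightarrow> 'g list \<Rightarrow> complex"
    and F :: "'g \<Rightarrow> 'g \<Rightarrow> 'g"
  assumes "finite_dimensional_vector_space scale Basis"
    and "quadratic_space scale B"
    and "I \<in> ext_power scale 3"
    and "D = (\<lambda>\<Omega> ys. - (1 / 2) * ad_P scale B I \<Omega> ys)"
    and "F = associated_map scale D"
  shows "(lie_structure scale F \<longleftrightarrow> super_poisson scale B I I = (\<lambda>_. 0)) \<and>
    (lie_structure scale F \<longrightarrow>
      (\<forall>X Y Z. I [X, Y, Z] = B (F X Y) Z) \<and>
      invariant_form F B \<and>
      quadratic_lie_algebra scale F B)"
proof -
  note fd = assms(1) and q = assms(2) and I = assms(3)
  have b: "bilinear_map scale (*) B" and sym: "\<And>x y. B x y = B y x"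
    and nd: "\<And>x. (\<And>y. B x y = 0) \<Longrightarrow> x = 0"
    using q by (auto simp: quadratic_space_def)
  note bs = bilinear_mapD[OF b] bilinear_map_sum[OF b] bilinear_map_zero_diff[OF b]
  obtain E where E: "orthonormal_basis scale B E"
    using orthonormal_basis_exists[OF fd q] ..
  note expand = orthonormal_basis_expand[OF fd q E]
  have F_eq: "F = (\<lambda>Y Z. \<Sum>X\<in>E. scale (I [X, Y, Z]) X)"
    unfolding assms(4,5) by (rule associated_map_ad_P_3(2)[OF fd q E I])
  have skew: "skew_bilinear scale F"
    unfolding F_eq by (rule associated_map_ad_P_3(1)[OF fd q E I])
  note anti = ext_power_3_skew[OF I]
  have cyc: "I [x, y, z] = I [y, z, x]" for x y z
    by (simp add: anti(1)[of y x] anti(2)[of y z x])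
  have IB: "B (F X Y) Z = I [X, Y, Z]" for X Y Z
  proof -
    note m = Vector_Spaces.linear.axioms(3)[OF ext_power_3_linear(1)[OF I]]
    \<comment> \<open>Expanding \<open>Z\<close> in \<open>E\<close> in the first slot produces the
      coefficients \<open>I [e, X, Y]\<close>, which are also the coordinates of
      \<open>F X Y\<close>. A cyclic shift, being even, brings \<open>Z\<close> back to the last
      slot.\<close>
    have "I [Z, X, Y] = I [(\<Sum>e\<in>E. scale (B e Z) e), X, Y]"
      by (rule arg_cong[OF expand(2)])
    also have "\<dots> = B (F X Y) Z"
      by (simp add: module_hom.sum[OF m] module_hom.scale[OF m] F_eq bs mult.commute)
    finally show ?thesis using cyc[of Z X Y] by simp
  qed
  \<comment> \<open>Through \<open>IB\<close> and the symmetry of \<open>B\<close>, invariance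
    becomes skew symmetry of \<open>I\<close> in its last two arguments.\<close>
  have inv: "invariant_form F B"
    unfolding invariant_form_def
  proof (intro allI)
    fix x y z
    show "B (F x y) z = - B y (F x z)"
      by (simp add: IB sym[of y] anti(2)[of x z y])
  qed
  \<comment> \<open>A complex number equal to its own negative is zero, so
    \<open>I [x, x, z] = 0\<close> for every \<open>z\<close>, and nondegeneracy concludes.\<close>
  have Fxx: "F x x = 0" for x
    using anti(1)[of x x] by (intro nd) (simp add: IB)
  \<comment> \<open>\<open>I [X, x, y]\<close> is the coordinate of \<open>F x y\<close> along
    \<open>X\<close>, so the left side is the form \<open>B\<close> written in orthonormal
    coordinates.\<close>
  have sumE: "(\<Sum>X\<in>E. I [X, x, y] * I [X, z, w]) = B (F x y) (F z w)" for x y z w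
  proof -
    have "B (F x y) (F z w) = (\<Sum>X\<in>E. I [X, x, y] * B X (F z w))"
      by (simp add: F_eq[THEN fun_cong, THEN fun_cong, of x y] bs)
    also have "\<dots> = (\<Sum>X\<in>E. I [X, x, y] * I [X, z, w])"
      by (simp add: sym[of _ "F z w"] IB cyc[of _ z w])
    finally show ?thesis by simp
  qed
  define J where "J x y z = F x (F y z) + F y (F z x) + F z (F x y)" for x y z
  \<comment> \<open>This frees \<open>a\<close> from the inner bracket, so that the terms below all
    become pairings with the same vector and can be collected.\<close>
  have BFF: "B (F a x) (F y z) = B (F x (F y z)) a" for a x y z
    by (simp add: IB cyc[of a x])
  have F_skew: "F x y = - F y x" for x y
    using skew unfolding skew_bilinear_def by blast
  have bF: "bilinear_map scale scale F" using skew by (simp add: skew_bilinear_def)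
  have minus: "B x (- y) = - B x y" "F x (- z) = - F x z" for x y z
    using bilinear_map_zero_diff(2,4)[OF b] bilinear_map_zero_diff(2,4)[OF bF] by (metis diff_0)+
  have bracket: "super_poisson scale B I I [a, b, c, d] = 4 * B (J b c d) a" for a b c d
  proof -
    \<comment> \<open>Both factors are the same contraction, so complementary shuffles contribute
      equal products with equal signs. The six terms become three doubled ones, and the bracket's
      own factor 2 makes the constant 4.\<close>
    have w: "wedge (interior X I) (interior X I) [a, b, c, d] =
      2 * (I [X, a, b] * I [X, c, d]) - 2 * (I [X, a, c] * I [X, b, d]) + 2 * (I [X, a, d] * I [X, b, c])" for X
      using I by (subst wedge_2_2) (auto simp: interior_def ext_power_def)
    have "super_poisson scale B I I [a, b, c, d] =
      4 * (B (F a b) (F c d) - B (F a c) (F b d) + B (F a d) (F b c))"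
      by (simp add: super_poisson_3_3[OF fd q E I] w sum.distrib sum_subtractf sumE
          flip: sum_distrib_left)
    \<comment> \<open>By \<open>BFF\<close> the vectors paired with \<open>a\<close> are
      \<open>F b (F c d)\<close>, \<open>- F c (F b d)\<close> and \<open>F d (F b c)\<close>.
      Rewriting \<open>F b d\<close> as \<open>- F d b\<close> gives the cyclic sum.\<close>
    also have "\<dots> = 4 * B (J b c d) a"
      by (simp add: BFF J_def bs F_skew[of b d] minus)
    finally show ?thesis .
  qed
  have zero_iff: "super_poisson scale B I I = (\<lambda>_. 0) \<longleftrightarrow> (\<forall>x y z. J x y z = 0)"
  proof
    assume "super_poisson scale B I I = (\<lambda>_. 0)"
    \<comment> \<open>The slot \<open>a\<close> in \<open>bracket\<close> is arbitrary, so
      \<open>J b c d\<close> is orthogonal to every vector.\<close>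
    then show "\<forall>x y z. J x y z = 0"
      using bracket by (auto intro: nd)
  next
    assume J: "\<forall>x y z. J x y z = 0"
    show "super_poisson scale B I I = (\<lambda>_. 0)"
    proof
      fix ys
      show "super_poisson scale B I I ys = 0"
      proof (cases "length ys = 4")
        case True
        then obtain a b c d where "ys = [a, b, c, d]"
          by (auto simp: numeral_eq_Suc length_Suc_conv)
        then show ?thesis using bracket J by (simp add: bs)
      qed (simp add: super_poisson_3_3[OF fd q E I])
    qed
  qed
  \<comment> \<open>Bilinearity and \<open>F x x = 0\<close> are already established, so the Jacobi
    identity is the only remaining condition.\<close>
  have lie: "lie_structure scale F \<longleftrightarrow> (\<forall>x y z. J x y z = 0)"
    using bF Fxx by (simp add: lie_structure_def J_def)
  show ?thesis
    using lie zero_iff IB inv q by (auto simp: quadratic_lie_algebra_def)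
qed

end
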